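(* Consider a market with $k$ assets and a finite set $\mathcal X\subset[0,\infty)^k$ of feasible (nonzero) price relative vectors. Assume that none of the assets is dominated by a portfolio of the other assets. Suppose that the Bregman divergence $$W(\vec b_P,P)-W(\vec b_Q,P)$$ is proportional to information divergence $D(P\Vert Q)$, i.e. there is a constant $c>0$ such that $W(\vec b_P,P)-W(\vec b_Q,P)=c\cdot D(P\Vert Q)$ for all probability measures $P,Q$ on $\mathcal X$. Then the measures $P$ and $Q$ are supported by $k$ distinct price relative vectors of the form $(o_1,0,0,\dots,0),(0,o_2,0,\dots,0),\dots,(0,0,\dots,0,o_k)$ with $o_1,\dots,o_k>0$; that is, $\mathcal X$ consists of exactly these $k$ vectors.
   Context: A price relative vector $\vec X=(X_1,\dots,X_k)$ lists, for each of $k$ assets, the nonnegative factor by which the value of the asset is multiplied in one trading period. A portfolio is a probability vector $\vec b=(b_1,\dots,b_k)$; asset $i$ is identified with the basis vector $\vec e_i$. A portfolio $\vec b_1$ dominates $\vec b_2$ if $\langle\vec X,\vec b_1\rangle\ge\langle\vec X,\vec b_2\rangle$ for every $\vec X\in\mathcal X$. Asset $i$ is dominated by a portfolio of the other assets if some portfolio $\vec b$ with $b_i=0$ dominates $\vec e_i$. For a probability measure $P$ on $\mathcal X$ let $W(\vec b,P)=E_P[\log\langle\vec X,\vec b\rangle]\in[-\infty,\infty)$, with $\log 0=-\infty$ and $0\cdot(-\infty)=0$. Let $\vec b_P$ denote a portfolio maximizing $W(\cdot,P)$ (an optimal portfolio for $P$). The quantity $W(\vec b_P,P)-W(\vec b_Q,P)$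 is the regret of using a portfolio optimal for $Q$ when the distribution is $P$; if $\vec b_Q$ is not uniquely determined, the minimum over all portfolios $\vec b$ optimal for $Q$ is taken. The maximal values $W(\vec b_P,P)$ are assumed finite, equivalently no feasible price relative vector is the zero vector. Information divergence is $D(P\Vert Q)=\sum_x P(x)\log\frac{P(x)}{Q(x)}\in[0,\infty]$. *)

theory Defs
  imports "HOL-Probability.Probability"
begin

text \<open>
  The \<open>k\<close> assets are the elements of a finite type \<open>'k\<close>; price relative vectors and portfolios
  are vectors in \<open>real ^ 'k\<close>, and asset \<open>i\<close> is the basis vector \<open>axis i 1\<close>. A probability measure
  on a finite set \<open>X\<close> of price relative vectors is a \<open>pmf\<close> whose support is contained in \<open>X\<close>.
\<close>

definition portfolio :: "(real ^ 'k::finite) \<Rightarrow> bool" where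
  "portfolio b \<longleftrightarrow> (\<forall>i. 0 \<le> b $ i) \<and> (\<Sum>i\<in>UNIV. b $ i) = 1"

definition dominates :: "(real ^ 'k::finite) set \<Rightarrow> real ^ 'k \<Rightarrow> real ^ 'k \<Rightarrow> bool" where
  "dominates X b1 b2 \<longleftrightarrow> (\<forall>x\<in>X. x \<bullet> b1 \<ge> x \<bullet> b2)"

definition dominated_asset :: "(real ^ 'k::finite) set \<Rightarrow> 'k \<Rightarrow> bool" where
  "dominated_asset X i \<longleftrightarrow> (\<exists>b. portfolio b \<and> b $ i = 0 \<and> dominates X b (axis i 1))"

text \<open>Natural logarithm with \<open>log 0 = - \<infinity>\<close>; it is only applied to nonnegative arguments.\<close>

definition elog :: "real \<Rightarrow> ereal" where
  "elog t = (if t \<le> 0 then - \<infinity> else ereal (ln t))"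

text \<open>
  Expected logarithmic growth of \<open>b\<close> under a finitely supported \<open>P\<close>. The sum may be restricted
  to the support of \<open>P\<close> because of the convention \<open>0 \<cdot> (- \<infinity>) = 0\<close>.
\<close>

definition W :: "real ^ 'k::finite \<Rightarrow> (real ^ 'k) pmf \<Rightarrow> ereal" where
  "W b P = (\<Sum>x\<in>set_pmf P. ereal (pmf P x) * elog (x \<bullet> b))"

definition optimal :: "(real ^ 'k::finite) pmf \<Rightarrow> real ^ 'k \<Rightarrow> bool" where
  "optimal P b \<longleftrightarrow> is_arg_max (\<lambda>b. W b P) portfolio b"

definition opt_portfolio :: "(real ^ 'k::finite) pmf \<Rightarrow> real ^ 'k" where
  "opt_portfolio P = (SOME b. optimal P b)"

text \<open>
  The regret \<open>W(b\<^sub>P, P) - W(b\<^sub>Q, P)\<close>, minimized over all portfolios \<open>b\<^sub>Q\<close> that are optimal for \<open>Q\<close>.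
  For finitely supported \<open>P\<close> and \<open>Q\<close> on nonnegative nonzero vectors the optimal portfolios form
  a nonempty compact set and \<open>W(\<cdot>, P)\<close> is upper semicontinuous, so the infimum is a minimum;
  the first term is finite, so the difference is well defined (and \<open>\<infinity>\<close> if \<open>W b P = - \<infinity>\<close>).
\<close>

definition regret :: "(real ^ 'k::finite) pmf \<Rightarrow> (real ^ 'k) pmf \<Rightarrow> ereal" where
  "regret P Q = (INF b\<in>{b. optimal Q b}. W (opt_portfolio P) P - W b P)"

text \<open>
  Information divergence with the conventions \<open>0 log (0/q) = 0\<close> and \<open>p log (p/0) = \<infinity>\<close> for \<open>p > 0\<close>.
  The real-valued \<open>KL_divergence\<close> does not take the value \<open>\<infinity>\<close>.
\<close>

definition info_divergence :: "'a pmf \<Rightarrow> 'a pmf \<Rightarrow> ereal" where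
  "info_divergence P Q =
     (\<Sum>x\<in>set_pmf P. if pmf Q x = 0 then \<infinity> else ereal (pmf P x * ln (pmf P x / pmf Q x)))"

end

theory Submission
  imports Defs
begin

text \<open>
  Normalise the price relatives by \<open>m\<^sub>x = max\<^sub>i x\<^sub>i\<close>. Comparing the regret with the divergence for
  \<open>P = \<delta>\<^sub>x\<close> shows that an optimal portfolio \<open>b\<close> for \<open>Q\<close> satisfies \<open>\<langle>x, b\<rangle> = m\<^sub>x Q(x)\<^sup>c\<close> for every \<open>x\<close>
  in the support of \<open>Q\<close>, and \<open>\<langle>x, b\<rangle> = 0\<close> for all other \<open>x\<close>. Taking \<open>Q = \<delta>\<^sub>y\<close>, the best asset \<open>i\<^sub>y\<close>
  for \<open>y\<close> is worthless under every \<open>x \<noteq> y\<close>. The first order condition for optimality becomes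
  \<open>\<Sum>\<^sub>x Q(x)\<^sup>1\<^sup>-\<^sup>c x\<^sub>j / m\<^sub>x \<le> 1\<close> for every asset \<open>j\<close>, with equality for some \<open>j\<close>. For \<open>Q\<close> on two points
  and \<open>c > 1\<close> this fails at \<open>j = i\<^sub>x\<close>; for \<open>c < 1\<close> the left hand side is strictly concave in \<open>Q\<close>, so
  each of the finitely many assets attains equality only once, although every \<open>Q\<close> needs one. Hence
  \<open>c = 1\<close> (unless there is only one price relative vector), so \<open>\<Sum>\<^sub>x x\<^sub>j / m\<^sub>x \<le> 1\<close>, which means that a
  mixture of the assets \<open>i\<^sub>x\<close> dominates \<open>j\<close>. So every asset is one of the \<open>i\<^sub>x\<close>.
\<close>

section \<open>Portfolios and expected logarithmic growth\<close>

lemma portfolio_axis: "portfolio (axis i 1)"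
  by (simp add: portfolio_def axis_def)

lemma inner_eq_sum: "x \<bullet> b = (\<Sum>i\<in>UNIV. b $ i * x $ i)" for x b :: "real ^ 'k::finite"
  by (simp add: inner_vec_def mult.commute)

lemma portfolio_mix:
  assumes "portfolio b" "portfolio w" "0 \<le> t" "t \<le> 1"
  shows "portfolio ((1 - t) *\<^sub>R b + t *\<^sub>R w)"
  using assms by (simp add: portfolio_def sum.distrib flip: sum_distrib_left)

lemma inner_portfolio_nonneg:
  assumes "\<And>i. 0 \<le> x $ i" "portfolio b"
  shows "0 \<le> x \<bullet> b"
  using assms by (auto simp: inner_eq_sum portfolio_def intro!: sum_nonneg)

lemma portfolio_const: "portfolio ((\<chi> i. 1 / CARD('k)) :: real ^ 'k::finite)"
  by (simp add: portfolio_def)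

lemma inner_const_portfolio_pos:
  fixes x :: "real ^ 'k::finite"
  assumes "\<And>i. 0 \<le> x $ i" "x \<noteq> 0"
  shows "0 < x \<bullet> (\<chi> i. 1 / CARD('k))"
proof -
  obtain i where "x $ i \<noteq> 0"
    using \<open>x \<noteq> 0\<close> by (auto simp: vec_eq_iff)
  with assms(1)[of i] have "0 < x $ i" by simp
  then have "0 < (\<Sum>i\<in>UNIV. x $ i)"
    using assms(1) by (intro sum_pos2[of _ i]) auto
  then show ?thesis
    by (simp add: inner_vec_def flip: sum_divide_distrib)
qed

lemma W_eq_ereal:
  assumes "\<And>x. x \<in> set_pmf P \<Longrightarrow> 0 < x \<bullet> b"
  shows "W b P = ereal (\<Sum>x\<in>set_pmf P. pmf P x * ln (x \<bullet> b))"
proof -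
  have "W b P = (\<Sum>x\<in>set_pmf P. ereal (pmf P x * ln (x \<bullet> b)))"
    unfolding W_def using assms by (intro sum.cong) (force simp: elog_def)+
  then show ?thesis by simp
qed

lemma W_eq_MInfty:
  assumes "finite (set_pmf P)" "x \<in> set_pmf P" "x \<bullet> b \<le> 0"
  shows "W b P = - \<infinity>"
proof -
  have pos: "0 < pmf P y" if "y \<in> set_pmf P" for y
    using that by (simp add: pmf_positive)
  \<comment> \<open>A finite \<open>ereal\<close> sum is infinite in absolute value as soon as one
    summand is; excluding \<open>\<infinity>\<close> leaves \<open>- \<infinity>\<close>.\<close>
  have "W b P \<noteq> \<infinity>"
    using pos by (auto simp: W_def sum_Pinfty elog_def split: if_splits)
  moreover have "\<bar>ereal (pmf P x) * elog (x \<bullet> b)\<bar> = \<infinity>"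
    using pos[OF assms(2)] assms(3) by (simp add: elog_def)
  then have "\<bar>W b P\<bar> = \<infinity>"
    unfolding W_def sum_Inf using assms(1,2) by (intro conjI bexI[of _ x])
  ultimately show ?thesis by (cases "W b P") auto
qed

lemma W_return_pmf: "W b (return_pmf x) = elog (x \<bullet> b)"
  by (simp add: W_def flip: one_ereal_def)

section \<open>Optimal portfolios and their first order conditions\<close>

lemma optimal_iff: "optimal P b \<longleftrightarrow> portfolio b \<and> (\<forall>w. portfolio w \<longrightarrow> W w P \<le> W b P)"
  by (auto simp: optimal_def is_arg_max_linorder)

text \<open>The uniform portfolio has finite growth, so an optimal one cannot be ruined at a point
  of the support.\<close>

lemma optimal_inner_pos:
  fixes P :: "(real ^ 'k::finite) pmf"
  assumes "finite (set_pmf P)" "\<And>x i. x \<in> set_pmf P \<Longrightarrow> 0 \<le> x $ i" "0 \<notin> set_pmf P"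
    and "optimal P b" "x \<in> set_pmf P"
  shows "0 < x \<bullet> b"
proof (rule ccontr)
  assume "\<not> 0 < x \<bullet> b"
  with assms have "W b P = - \<infinity>"
    by (intro W_eq_MInfty) auto
  moreover have "0 < y \<bullet> (\<chi> i. 1 / CARD('k))" if "y \<in> set_pmf P" for y
    using assms(2,3) that by (intro inner_const_portfolio_pos) auto
  then have "\<bar>W (\<chi> i. 1 / CARD('k)) P\<bar> \<noteq> \<infinity>"
    by (subst W_eq_ereal) auto
  moreover have "W (\<chi> i. 1 / CARD('k)) P \<le> W b P"
    using assms(4) portfolio_const by (auto simp: optimal_iff)
  ultimately show False by auto
qed

text \<open>Moving from \<open>b\<close> towards \<open>w\<close> changes the growth at initial rate
  \<open>l\<close>, which is the sum minus 1. A positive rate would make some mixture strictly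
  better than \<open>b\<close>.\<close>

lemma optimal_first_order:
  assumes fin: "finite (set_pmf P)" and nonneg: "\<And>x i. x \<in> set_pmf P \<Longrightarrow> 0 \<le> x $ i"
    and "0 \<notin> set_pmf P" and opt: "optimal P b" and w: "portfolio w"
  shows "(\<Sum>x\<in>set_pmf P. pmf P x * (x \<bullet> w) / (x \<bullet> b)) \<le> 1"
proof (rule ccontr)
  assume less: "\<not> ?thesis"
  have pos: "0 < x \<bullet> b" if "x \<in> set_pmf P" for x
    using optimal_inner_pos assms that by blast
  define f where "f t = (\<Sum>x\<in>set_pmf P. pmf P x * ln ((1 - t) * (x \<bullet> b) + t * (x \<bullet> w)))" for t
  define l where "l = (\<Sum>x\<in>set_pmf P. pmf P x * ((x \<bullet> w - x \<bullet> b) / (x \<bullet> b)))"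
  have "l = (\<Sum>x\<in>set_pmf P. pmf P x * (x \<bullet> w) / (x \<bullet> b) - pmf P x)"
    unfolding l_def using pos
    by (intro sum.cong refl) (simp add: diff_divide_distrib right_diff_distrib order_less_imp_not_eq2)
  also have "\<dots> = (\<Sum>x\<in>set_pmf P. pmf P x * (x \<bullet> w) / (x \<bullet> b)) - 1"
    using fin by (simp add: sum_subtractf sum_pmf_eq_1)
  finally have "0 < l" using less by simp
  moreover have "DERIV f 0 :> l"
    unfolding f_def l_def
    by (rule DERIV_sum) (auto intro!: derivative_eq_intros dest: pos)
  ultimately have "\<exists>d>0. \<forall>h>0. h < d \<longrightarrow> f 0 < f (0 + h)"
    by (intro DERIV_pos_inc_right)
  then obtain d where d: "d > 0" "\<And>h. 0 < h \<Longrightarrow> h < d \<Longrightarrow> f 0 < f h"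
    by auto
  define h where "h = min (d / 2) (1 / 2)"
  have h: "0 < h" "h < d" "h < 1" using d(1) by (auto simp: h_def)
  define v where "v = (1 - h) *\<^sub>R b + h *\<^sub>R w"
  have inner_v: "x \<bullet> v = (1 - h) * (x \<bullet> b) + h * (x \<bullet> w)" for x
    by (simp add: v_def inner_add_right)
  have "0 < x \<bullet> v" if "x \<in> set_pmf P" for x
    unfolding inner_v using pos[OF that] h inner_portfolio_nonneg[OF nonneg[OF that] w]
    by (simp add: add_pos_nonneg)
  then have "W v P = ereal (f h)"
    by (simp add: W_eq_ereal f_def inner_v)
  moreover have "W b P = ereal (f 0)"
    using pos by (simp add: W_eq_ereal f_def)
  moreover have "W v P \<le> W b P"
    using opt w h portfolio_mix[of b w h] by (simp add: optimal_iff v_def)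
  ultimately show False
    using d(2)[of h] h by simp
qed

text \<open>Complementary slackness: the average of these sums with weights \<open>b $ j\<close> is
  exactly 1, so they cannot all lie below 1.\<close>

lemma optimal_first_order_eq:
  assumes fin: "finite (set_pmf P)" and nonneg: "\<And>x i. x \<in> set_pmf P \<Longrightarrow> 0 \<le> x $ i"
    and "0 \<notin> set_pmf P" and opt: "optimal P b"
  shows "\<exists>j. (\<Sum>x\<in>set_pmf P. pmf P x * x $ j / (x \<bullet> b)) = 1"
proof (rule ccontr)
  let ?K = "\<lambda>j. \<Sum>x\<in>set_pmf P. pmf P x * x $ j / (x \<bullet> b)"
  assume "\<not> ?thesis"
  moreover have "?K j \<le> 1" for j
    using optimal_first_order[OF assms portfolio_axis[of j]] by (simp add: inner_axis)
  ultimately have less: "?K j < 1" for j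
    by (metis order_less_le)
  have b: "portfolio b" using opt by (simp add: optimal_iff)
  have "(\<Sum>j\<in>UNIV. b $ j * ?K j) = (\<Sum>x\<in>set_pmf P. pmf P x * (x \<bullet> b) / (x \<bullet> b))"
    unfolding inner_eq_sum sum_distrib_left sum_divide_distrib
    by (subst sum.swap) (intro sum.cong refl, simp add: mult_ac)
  also have "\<dots> = (\<Sum>x\<in>set_pmf P. pmf P x)"
    using optimal_inner_pos[OF assms] by (intro sum.cong) force+
  also have "\<dots> = (\<Sum>j\<in>UNIV. b $ j)"
    using fin b by (simp add: sum_pmf_eq_1 portfolio_def)
  finally have "(\<Sum>j\<in>UNIV. b $ j * (1 - ?K j)) = 0"
    by (simp add: right_diff_distrib sum_subtractf)
  moreover have "0 \<le> b $ j * (1 - ?K j)" for j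
    using less[of j] b by (simp add: portfolio_def)
  ultimately have "b $ j * (1 - ?K j) = 0" for j
    by (simp add: sum_nonneg_eq_0_iff)
  moreover have "1 - ?K j \<noteq> 0" for j using less[of j] by linarith
  ultimately have "b $ j = 0" for j by (metis mult_eq_0_iff)
  with b show False by (simp add: portfolio_def)
qed

text \<open>Each optimal portfolio is tested in the first order condition of the other. With
  \<open>r\<close> the ratio of the two returns, the expectation of \<open>r + 1 / r - 2\<close> is
  then at most 0, yet this quantity is nonnegative and vanishes only at
  \<open>r = 1\<close>.\<close>

lemma optimal_inner_unique:
  assumes "finite (set_pmf P)" "\<And>x i. x \<in> set_pmf P \<Longrightarrow> 0 \<le> x $ i" "0 \<notin> set_pmf P"
    and b: "optimal P b" and b': "optimal P b'" and x: "x \<in> set_pmf P"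
  shows "x \<bullet> b = x \<bullet> b'"
proof -
  have pos: "0 < y \<bullet> b" "0 < y \<bullet> b'" if "y \<in> set_pmf P" for y
    using optimal_inner_pos assms that by blast+
  let ?g = "\<lambda>y. pmf P y * ((y \<bullet> b - y \<bullet> b')\<^sup>2 / ((y \<bullet> b) * (y \<bullet> b')))"
  have "(\<Sum>y\<in>set_pmf P. ?g y) =
      (\<Sum>y\<in>set_pmf P. pmf P y * (y \<bullet> b') / (y \<bullet> b) + pmf P y * (y \<bullet> b) / (y \<bullet> b') - 2 * pmf P y)"
  proof (intro sum.cong refl)
    fix y assume "y \<in> set_pmf P"
    then have "y \<bullet> b \<noteq> 0" "y \<bullet> b' \<noteq> 0" using pos by force+
    then show "?g y = pmf P y * (y \<bullet> b') / (y \<bullet> b) + pmf P y * (y \<bullet> b) / (y \<bullet> b') - 2 * pmf P y"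
      by (simp add: field_simps power2_eq_square)
  qed
  also have "\<dots> \<le> 1 + 1 - 2 * (\<Sum>y\<in>set_pmf P. pmf P y)"
    unfolding sum_subtractf sum.distrib sum_distrib_left[symmetric]
    using optimal_first_order[OF assms(1-3) b, of b'] optimal_first_order[OF assms(1-3) b', of b] b b'
    by (intro diff_right_mono add_mono) (auto simp: optimal_iff)
  also have "\<dots> = 0" using assms(1) by (simp add: sum_pmf_eq_1)
  finally have "sum ?g (set_pmf P) \<le> 0" .
  moreover have nonneg: "0 \<le> ?g y" if "y \<in> set_pmf P" for y
    using pos[OF that] by simp
  ultimately have "sum ?g (set_pmf P) = 0"
    by (meson order_antisym sum_nonneg)
  then have "?g x = 0"
    using nonneg assms(1) x by (simp add: sum_nonneg_eq_0_iff)
  with pos[OF x] x show ?thesis by (auto simp: set_pmf_iff)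
qed

section \<open>Strict concavity of powers, and two-point measures\<close>

lemma powr_midpoint_strict:
  fixes p q a :: real
  assumes "0 < a" "a < 1" "0 < p" "0 < q" "p \<noteq> q"
  shows "(p powr a + q powr a) / 2 < ((p + q) / 2) powr a"
proof -
  define m where "m = (p + q) / 2"
  have "0 < m" using assms by (simp add: m_def)
  \<comment> \<open>The power lies strictly below its tangent at 1; for \<open>p / m\<close> and
    \<open>q / m\<close> the linear terms will cancel, \<open>m\<close> being the midpoint.\<close>
  have tangent: "r powr a < 1 + a * (r - 1)" if "0 < r" "r \<noteq> 1" for r
  proof -
    define s where "s = 1 + a * (r - 1)"
    have s: "s = (1 - a) + a * r" by (simp add: s_def algebra_simps)
    have "0 < s" unfolding s using assms that by (intro add_pos_pos) auto
    have "s \<noteq> r"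
    proof
      assume "s = r"
      then have "(1 - a) * (r - 1) = 0" by (simp add: s_def algebra_simps)
      with assms that show False by simp
    qed
    have "ln (r / s) < r / s - 1"
      using ln_le_minus_one[of "r / s"] ln_eq_minus_one[of "r / s"] \<open>0 < s\<close> \<open>s \<noteq> r\<close> that
      by (auto simp: less_le)
    \<comment> \<open>The logarithms combine to \<open>a * ln r - ln s\<close>, and the right hand
      side vanishes because \<open>s\<close> is the weighted mean of \<open>r\<close> and 1.\<close>
    then have "a * ln (r / s) + (1 - a) * ln (1 / s) < a * (r / s - 1) + (1 - a) * (1 / s - 1)"
      using assms \<open>0 < s\<close> ln_le_minus_one[of "1 / s"]
      by (intro add_less_le_mono mult_strict_left_mono mult_left_mono) auto
    also have "\<dots> = 0" using \<open>0 < s\<close> by (simp add: field_simps) (simp add: s algebra_simps)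
    finally have "a * ln r < ln s"
      using \<open>0 < s\<close> that by (simp add: ln_div algebra_simps)
    then have "exp (a * ln r) < exp (ln s)" by (simp only: exp_less_cancel_iff)
    then show ?thesis
      using \<open>0 < s\<close> that by (simp add: powr_def flip: s_def)
  qed
  have "p / m \<noteq> 1" "q / m \<noteq> 1" using assms \<open>0 < m\<close> by (auto simp: m_def)
  then have "(p / m) powr a + (q / m) powr a < 1 + a * (p / m - 1) + (1 + a * (q / m - 1))"
    using assms \<open>0 < m\<close> by (intro add_strict_mono tangent) auto
  also have "\<dots> = 2 + a * ((p + q) / m - 2)"
    by (simp add: algebra_simps add_divide_distrib)
  also have "(p + q) / m = 2" using \<open>0 < m\<close> by (simp add: m_def field_simps)
  finally have "(p / m) powr a + (q / m) powr a < 2" by simp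
  then show ?thesis
    using \<open>0 < m\<close> assms unfolding m_def[symmetric] by (simp add: powr_divide field_simps)
qed

lemma ex_two_point_pmf:
  assumes "x \<noteq> y" "0 < q" "q < 1"
  shows "\<exists>Q. set_pmf Q = {x, y} \<and> pmf Q x = q \<and> pmf Q y = 1 - q"
proof -
  define f where "f t = (if t then x else y)" for t
  have "inj f" using assms by (auto simp: f_def inj_def)
  with assms pmf_map_inj'[of f "bernoulli_pmf q" True] pmf_map_inj'[of f "bernoulli_pmf q" False]
  have "pmf (map_pmf f (bernoulli_pmf q)) x = q" "pmf (map_pmf f (bernoulli_pmf q)) y = 1 - q"
    by (simp_all add: f_def)
  moreover have "set_pmf (map_pmf f (bernoulli_pmf q)) = {x, y}"
    using assms by (auto simp: f_def UNIV_bool)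
  ultimately show ?thesis by blast
qed

section \<open>Best assets and optimality for point masses\<close>

definition best_asset :: "real ^ 'k::finite \<Rightarrow> 'k" where
  "best_asset x = (SOME i. \<forall>j. x $ j \<le> x $ i)"

lemma le_best_asset: "x $ j \<le> x $ best_asset x"
proof -
  have "Max (range (($) x)) \<in> range (($) x)" by (intro Max_in) auto
  then obtain i where "x $ i = Max (range (($) x))" by (metis rangeE)
  then have "\<forall>j. x $ j \<le> x $ i" by simp
  then have "\<forall>j. x $ j \<le> x $ best_asset x"
    unfolding best_asset_def by (rule someI)
  then show ?thesis by blast
qed

lemma inner_portfolio_le:
  assumes "portfolio b"
  shows "x \<bullet> b \<le> x $ best_asset x"
proof -
  have "x \<bullet> b \<le> (\<Sum>i\<in>UNIV. b $ i * x $ best_asset x)"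
    unfolding inner_eq_sum using assms
    by (intro sum_mono mult_left_mono le_best_asset) (simp add: portfolio_def)
  then show ?thesis using assms by (simp add: portfolio_def flip: sum_distrib_right)
qed

lemma elog_mono: "s \<le> t \<Longrightarrow> elog s \<le> elog t"
  by (simp add: elog_def)

lemma optimal_best_asset: "optimal (return_pmf x) (axis (best_asset x) 1)"
  by (simp add: optimal_iff portfolio_axis W_return_pmf inner_axis elog_mono inner_portfolio_le)

lemma W_opt_portfolio_return_pmf:
  "W (opt_portfolio (return_pmf x)) (return_pmf x) = elog (x $ best_asset x)"
proof -
  have "optimal (return_pmf x) (opt_portfolio (return_pmf x))"
    unfolding opt_portfolio_def by (rule someI[where P = "optimal _"], rule optimal_best_asset)
  then have "W (opt_portfolio (return_pmf x)) (return_pmf x) = W (axis (best_asset x) 1) (return_pmf x)"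
    using optimal_best_asset[of x] by (intro antisym) (auto simp: optimal_iff)
  then show ?thesis by (simp add: W_return_pmf inner_axis)
qed

section \<open>Consequences of proportionality between regret and divergence\<close>

locale proportional_regret =
  fixes X :: "(real ^ 'k::finite) set" and c :: real
  assumes finite_X: "finite X"
    and nonneg: "x \<in> X \<Longrightarrow> 0 \<le> x $ i"
    and nonzero: "0 \<notin> X"
    and c_pos: "0 < c"
    and regret_eq: "set_pmf P \<subseteq> X \<Longrightarrow> set_pmf Q \<subseteq> X \<Longrightarrow> regret P Q = ereal c * info_divergence P Q"
begin

lemma best_asset_pos:
  assumes "x \<in> X"
  shows "0 < x $ best_asset x"
proof (rule ccontr)
  assume "\<not> ?thesis"
  then have "x $ i = 0" for i
    using nonneg[OF assms, of i] le_best_asset[of x i] by linarith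
  with assms nonzero show False by (metis vec_eq_iff zero_index)
qed

text \<open>No compactness is needed: without an optimal portfolio for \<open>Q\<close>, the regret at \<open>(Q, Q)\<close> is the
  infimum of the empty set, \<open>\<infinity>\<close>, but the divergence is \<open>0\<close>.\<close>

lemma ex_optimal:
  assumes "set_pmf Q \<subseteq> X"
  shows "\<exists>b. optimal Q b"
proof (rule ccontr)
  assume "\<not> ?thesis"
  then have "regret Q Q = \<infinity>" by (simp add: regret_def top_ereal_def)
  moreover have "info_divergence Q Q = (\<Sum>x\<in>set_pmf Q. ereal 0)"
    unfolding info_divergence_def by (intro sum.cong) (auto simp: set_pmf_iff)
  ultimately show False using regret_eq[OF assms assms] by simp
qed

text \<open>The divergence of the point mass at \<open>x\<close> from \<open>Q\<close> is
  \<open>- ln (pmf Q x)\<close>. All optimal portfolios for \<open>Q\<close> have the same return at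
  \<open>x\<close>, so the regret is an infimum of a constant and can be solved for
  \<open>x \<bullet> b\<close>.\<close>

lemma optimal_inner_eq:
  assumes Q: "set_pmf Q \<subseteq> X" and b: "optimal Q b" and x: "x \<in> set_pmf Q"
  shows "x \<bullet> b = x $ best_asset x * pmf Q x powr c"
proof -
  have fin: "finite (set_pmf Q)" using Q finite_X by (rule finite_subset)
  have nn: "0 \<le> y $ i" if "y \<in> set_pmf Q" for y i using Q nonneg that by blast
  have nz: "0 \<notin> set_pmf Q" using Q nonzero by blast
  note Q_facts = fin nn nz
  have q: "0 < pmf Q x" using x by (simp add: pmf_positive)
  have m: "0 < x $ best_asset x" using Q x best_asset_pos by blast
  have pos: "0 < x \<bullet> b" using optimal_inner_pos[OF Q_facts b x] .
  have "W b' (return_pmf x) = ereal (ln (x \<bullet> b))" if "optimal Q b'" for b'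
    using optimal_inner_unique[OF Q_facts that b x] pos by (simp add: W_return_pmf elog_def)
  then have "regret (return_pmf x) Q = (INF b\<in>{b. optimal Q b}. ereal (ln (x $ best_asset x) - ln (x \<bullet> b)))"
    unfolding regret_def using m pos optimal_inner_unique[OF Q_facts _ b x]
    by (intro INF_cong) (auto simp: W_opt_portfolio_return_pmf elog_def)
  also have "\<dots> = (INF b'\<in>{b. optimal Q b}. ereal (ln (x $ best_asset x) - ln (x \<bullet> b)))"
    using optimal_inner_unique[OF Q_facts _ b x] by (intro INF_cong) auto
  also have "\<dots> = ereal (ln (x $ best_asset x) - ln (x \<bullet> b))"
    using b by (intro INF_const) auto
  finally have "ereal (ln (x $ best_asset x) - ln (x \<bullet> b)) = ereal c * info_divergence (return_pmf x) Q"
    using regret_eq[of "return_pmf x" Q] Q x by auto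
  also have "info_divergence (return_pmf x) Q = ereal (- ln (pmf Q x))"
    using q by (simp add: info_divergence_def ln_div)
  finally have "ln (x \<bullet> b) = ln (x $ best_asset x) + c * ln (pmf Q x)"
    by simp
  also have "\<dots> = ln (x $ best_asset x * pmf Q x powr c)"
    using m q by (simp add: ln_mult ln_powr)
  finally show ?thesis using pos m q by simp
qed

text \<open>Distinct point masses have infinite divergence, so every portfolio optimal for
  \<open>y\<close>, in particular its best asset, has infinite regret at \<open>x\<close>.\<close>

lemma best_asset_other_eq_0:
  assumes "x \<in> X" "y \<in> X" "x \<noteq> y"
  shows "x $ best_asset y = 0"
proof -
  have "regret (return_pmf x) (return_pmf y) = \<infinity>"
    using assms c_pos by (subst regret_eq) (auto simp: info_divergence_def)
  moreover have "regret (return_pmf x) (return_pmf y)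
      \<le> W (opt_portfolio (return_pmf x)) (return_pmf x) - W (axis (best_asset y) 1) (return_pmf x)"
    unfolding regret_def by (intro INF_lower) (simp add: optimal_best_asset)
  ultimately have "elog (x $ best_asset x) - elog (x $ best_asset y) = \<infinity>"
    unfolding W_opt_portfolio_return_pmf unfolding W_return_pmf by (simp add: inner_axis)
  then show ?thesis
    using best_asset_pos[OF assms(1)] nonneg[OF assms(1), of "best_asset y"]
    by (auto simp: elog_def split: if_splits)
qed

text \<open>Inserting the formula for \<open>x \<bullet> b\<close> into the optimality conditions
  eliminates the portfolio.\<close>

lemma first_order:
  assumes Q: "set_pmf Q \<subseteq> X"
  defines "f \<equiv> \<lambda>j. \<Sum>x\<in>set_pmf Q. pmf Q x powr (1 - c) * (x $ j / x $ best_asset x)"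
  shows "f j \<le> 1" and "\<exists>j. f j = 1"
proof -
  have fin: "finite (set_pmf Q)" using Q finite_X by (rule finite_subset)
  have nn: "0 \<le> y $ i" if "y \<in> set_pmf Q" for y i using Q nonneg that by blast
  have nz: "0 \<notin> set_pmf Q" using Q nonzero by blast
  note Q_facts = fin nn nz
  obtain b where b: "optimal Q b" using ex_optimal[OF Q] by blast
  have f: "f j = (\<Sum>x\<in>set_pmf Q. pmf Q x * x $ j / (x \<bullet> b))" for j
    unfolding f_def
  proof (intro sum.cong refl)
    fix x assume x: "x \<in> set_pmf Q"
    then have "0 < pmf Q x" by (simp add: pmf_positive)
    then show "pmf Q x powr (1 - c) * (x $ j / x $ best_asset x) = pmf Q x * x $ j / (x \<bullet> b)"
      using optimal_inner_eq[OF Q b x] by (simp add: powr_diff)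
  qed
  show "f j \<le> 1"
    using optimal_first_order[OF Q_facts b portfolio_axis[of j]] by (simp add: f inner_axis)
  show "\<exists>j. f j = 1"
    unfolding f by (rule optimal_first_order_eq[OF Q_facts b])
qed

lemma first_order_two_point:
  assumes "x \<in> X" "y \<in> X" "x \<noteq> y" "0 < q" "q < 1"
  defines "f \<equiv> \<lambda>j. q powr (1 - c) * (x $ j / x $ best_asset x) + (1 - q) powr (1 - c) * (y $ j / y $ best_asset y)"
  shows "f j \<le> 1" and "\<exists>j. f j = 1"
proof -
  obtain Q where Q: "set_pmf Q = {x, y}" "pmf Q x = q" "pmf Q y = 1 - q"
    using ex_two_point_pmf assms by metis
  then have "set_pmf Q \<subseteq> X" using assms by simp
  from first_order[OF this] show "f j \<le> 1" "\<exists>j. f j = 1"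
    using \<open>x \<noteq> y\<close> by (simp_all add: Q f_def)
qed

lemma c_eq_1:
  assumes "x \<in> X" "y \<in> X" "x \<noteq> y"
  shows "c = 1"
proof (rule ccontr)
  assume "c \<noteq> 1"
  \<comment> \<open>For the best asset of \<open>x\<close> the term of \<open>y\<close> vanishes,
    which leaves the bare power and rules out \<open>c > 1\<close>.\<close>
  have "(1 / 2) powr (1 - c) \<le> (1 :: real)"
    using first_order_two_point(1)[OF assms, of "1 / 2" "best_asset x"]
      best_asset_pos[OF assms(1)] best_asset_other_eq_0[of y x] assms by simp
  then have "c \<le> 1"
    using powr_less_mono'[of "1 / 2" "1 - c" 0] by force
  with \<open>c \<noteq> 1\<close> have c: "0 < 1 - c" "1 - c < 1" using c_pos by auto
  define f where "f j q = q powr (1 - c) * (x $ j / x $ best_asset x)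
      + (1 - q) powr (1 - c) * (y $ j / y $ best_asset y)" for j q
  have le: "f j q \<le> 1" if "0 < q" "q < 1" for j q
    unfolding f_def using first_order_two_point(1)[OF assms that] .
  have "\<exists>j. f j q = 1" if "q \<in> {0<..<1}" for q
    unfolding f_def using first_order_two_point(2)[OF assms] that by simp
  then obtain g where g: "\<And>q. q \<in> {0<..<1} \<Longrightarrow> f (g q) q = 1" by metis
  \<comment> \<open>Pigeonhole: infinitely many weights share finitely many assets, so some asset
    attains 1 at two different weights; strict concavity then pushes it above 1 at their
    midpoint.\<close>
  have "infinite {0<..<1::real}" by simp
  then have "\<not> inj_on g {0<..<1}"
    using finite_imageD[of g "{0<..<1}"] finite[of "g ` {0<..<1}"] by metis
  then obtain p q where pq: "0 < p" "p < 1" "0 < q" "q < 1" "p \<noteq> q" "g p = g q"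
    by (auto simp: inj_on_def)
  define u v where "u = x $ g q / x $ best_asset x" and "v = y $ g q / y $ best_asset y"
  have uv: "0 \<le> u" "0 \<le> v"
    unfolding u_def v_def using assms by (simp_all add: nonneg)
  have f_eq: "f (g q) t = t powr (1 - c) * u + (1 - t) powr (1 - c) * v" for t
    by (simp add: f_def u_def v_def)
  have eq: "f (g q) p = 1" "f (g q) q = 1"
    using g[of p] g[of q] pq by auto
  let ?m = "(p + q) / 2"
  have mid: "(1 - p + (1 - q)) / 2 = 1 - ?m" by (simp add: field_simps)
  have strict: "(p powr (1 - c) + q powr (1 - c)) / 2 < ?m powr (1 - c)"
    "((1 - p) powr (1 - c) + (1 - q) powr (1 - c)) / 2 < (1 - ?m) powr (1 - c)"
    unfolding mid[symmetric] using c pq by (intro powr_midpoint_strict; simp)+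
  have "u \<noteq> 0 \<or> v \<noteq> 0" using eq by (auto simp: f_eq)
  then have "(p powr (1 - c) + q powr (1 - c)) / 2 * u + ((1 - p) powr (1 - c) + (1 - q) powr (1 - c)) / 2 * v
      < ?m powr (1 - c) * u + (1 - ?m) powr (1 - c) * v"
  proof
    assume "u \<noteq> 0"
    then show ?thesis using strict uv by (intro add_less_le_mono mult_strict_right_mono mult_right_mono) auto
  next
    assume "v \<noteq> 0"
    then show ?thesis using strict uv by (intro add_le_less_mono mult_strict_right_mono mult_right_mono) auto
  qed
  also have "\<dots> = f (g q) ?m" by (simp only: f_eq)
  also have "\<dots> \<le> 1" using pq by (intro le) auto
  also have "1 = (f (g q) p + f (g q) q) / 2" using eq by simp
  finally show False by (simp add: f_eq field_simps)
qed

text \<open>With \<open>c = 1\<close> the powers in the first order condition are all 1, so any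
  measure with support \<open>X\<close> gives the bound; the uniform one is used.\<close>

lemma sum_relative_le_1: "(\<Sum>x\<in>X. x $ j / x $ best_asset x) \<le> 1"
proof (cases "\<exists>x\<in>X. \<exists>y\<in>X. x \<noteq> y")
  case True
  then have "c = 1" "X \<noteq> {}" using c_eq_1 by auto
  then show ?thesis
    using first_order(1)[of "pmf_of_set X" j] finite_X by (simp add: card_gt_0_iff)
next
  case False
  then consider "X = {}" | x where "X = {x}" by blast
  then show ?thesis
  proof cases
    case 2
    then show ?thesis using le_best_asset[of x j] best_asset_pos[of x] by simp
  qed simp
qed

text \<open>Holding the best asset of each \<open>x\<close> with weight
  \<open>x $ j / x $ best_asset x\<close> already reproduces the return of \<open>j\<close> at
  \<open>x\<close>. The weights sum to \<open>s\<close>, at most 1, and the spare mass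
  \<open>1 - s\<close> goes to the best asset of an arbitrary \<open>y\<close>.\<close>

lemma dominated_asset_if_not_best:
  assumes "X \<noteq> {}" "j \<notin> best_asset ` X"
  shows "dominated_asset X j"
proof -
  define s where "s = (\<Sum>x\<in>X. x $ j / x $ best_asset x)"
  obtain y where y: "y \<in> X" using assms by blast
  define b where "b = (\<Sum>x\<in>X. axis (best_asset x) (x $ j / x $ best_asset x)) + axis (best_asset y) (1 - s)"
  have s: "s \<le> 1" unfolding s_def by (rule sum_relative_le_1)
  have frac: "0 \<le> x $ j / x $ best_asset x" if "x \<in> X" for x
    using nonneg[OF that] by simp
  have axis_nonneg: "0 \<le> axis k t $ i" if "0 \<le> t" for k i :: 'k and t :: real
    using that by (simp add: axis_def)
  have sum_axis: "(\<Sum>i\<in>UNIV. axis k t $ i) = t" for k :: 'k and t :: real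
    by (simp add: axis_def)
  have "portfolio b"
    unfolding portfolio_def
  proof
    show "\<forall>i. 0 \<le> b $ i"
      unfolding b_def using frac s by (auto intro!: add_nonneg_nonneg sum_nonneg axis_nonneg)
    have "(\<Sum>i\<in>UNIV. b $ i) = (\<Sum>x\<in>X. \<Sum>i\<in>UNIV. axis (best_asset x) (x $ j / x $ best_asset x) $ i) + (1 - s)"
      unfolding b_def by (subst sum.swap) (simp add: sum.distrib sum_axis)
    then show "(\<Sum>i\<in>UNIV. b $ i) = 1" by (simp add: sum_axis s_def)
  qed
  moreover have "b $ j = 0"
    using assms y by (auto simp: b_def axis_def intro!: sum.neutral)
  moreover have "x $ j \<le> x \<bullet> b" if x: "x \<in> X" for x
  proof -
    have "x $ j = x \<bullet> axis (best_asset x) (x $ j / x $ best_asset x)"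
      using best_asset_pos[OF x] by (simp add: inner_axis)
    also have "\<dots> \<le> (\<Sum>z\<in>X. x \<bullet> axis (best_asset z) (z $ j / z $ best_asset z))"
      using nonneg[OF x] frac finite_X x by (intro member_le_sum) (auto simp: inner_axis simp del: times_divide_eq_right)
    also have "\<dots> \<le> x \<bullet> b"
      using nonneg[OF x] s by (simp add: b_def inner_add_right inner_sum_right inner_axis)
    finally show ?thesis .
  qed
  ultimately show ?thesis
    by (auto simp: dominated_asset_def dominates_def inner_axis)
qed

end

theorem theorem17:
  fixes X :: "(real ^ 'k::finite) set" and c :: real
  assumes "finite X" and "X \<noteq> {}"
    and "\<And>x i. x \<in> X \<Longrightarrow> 0 \<le> x $ i"
    and "0 \<notin> X"
    and "\<And>i. \<not> dominated_asset X i"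
    and "c > 0"
    and "\<And>P Q. set_pmf P \<subseteq> X \<Longrightarrow> set_pmf Q \<subseteq> X \<Longrightarrow> regret P Q = ereal c * info_divergence P Q"
  shows "\<exists>r :: 'k \<Rightarrow> real. (\<forall>i. r i > 0) \<and> X = {axis i (r i) | i. True} \<and> card X = CARD('k)"
proof -
  interpret proportional_regret X c
    using assms by unfold_locales auto
  have surj: "best_asset ` X = UNIV"
    using dominated_asset_if_not_best assms(2,5) by blast
  \<comment> \<open>A best asset shared by two vectors would have to be both worthless and positive
    at one of them.\<close>
  have inj: "inj_on best_asset X"
    using best_asset_other_eq_0 best_asset_pos by (metis inj_onI order_less_irrefl)
  \<comment> \<open>\<open>z i\<close> is the unique vector whose best asset is \<open>i\<close>;
    each other asset is best for another vector, hence worthless at \<open>z i\<close>.\<close>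
  define z where "z = the_inv_into X best_asset"
  have z: "z i \<in> X" "best_asset (z i) = i" for i
    unfolding z_def using the_inv_into_into[OF inj, of i X] f_the_inv_into_f[OF inj, of i] surj by auto
  define r where "r i = z i $ i" for i
  have z_eq: "z i = axis i (r i)" for i
  proof (unfold vec_eq_iff, intro allI)
    fix j
    show "z i $ j = axis i (r i) $ j"
    proof (cases "j = i")
      case False
      then have "z i \<noteq> z j" using z by metis
      then have "z i $ j = 0" using best_asset_other_eq_0[of "z i" "z j"] z by simp
      with False show ?thesis by (simp add: axis_def)
    qed (simp add: r_def axis_def)
  qed
  have "r i > 0" for i
    unfolding r_def using best_asset_pos[OF z(1), of i] z(2) by simp
  moreover have "X = range z"
  proof -
    have "z (best_asset x) = x" if "x \<in> X" for x
      unfolding z_def using inj that by (rule the_inv_into_f_f)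
    then show ?thesis using z(1) by (metis image_subset_iff rangeI subsetI subset_antisym)
  qed
  then have "X = {axis i (r i) | i. True}" by (auto simp: z_eq image_def)
  moreover have "card X = CARD('k)"
    using card_image[OF inj] surj by simp
  ultimately show ?thesis by blast
qed

end
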